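(* Let $S,K\subset\mathbb{R}$ be nonempty open bounded intervals, let $h>0$ and $M\ge 0$, and let $\mathbf{e}\in L^2(S,\mathbb{R}^2)$ with $\mathbf{e}\notin\operatorname{Ran} b_2^*$. Let $\phi_o\in L^2(K)$ be the unique minimizer of $\|b_2^*[\phi]-\mathbf{e}\|_{L^2(S,\mathbb{R}^2)}$ over all $\phi\in L^2(K)$ with $\|\phi\|_{L^2(K)}\le M$. Then there exists a unique $\lambda>0$ such that $$b_2\,b_2^*[\phi_o]+\lambda\,\phi_o=b_2[\mathbf{e}]\quad\text{in }L^2(K)$$ holds true and $\|\phi_o\|_{L^2(K)}=M$.
   Context: All $L^2(K)$ functions are real-valued, and $L^2(S,\mathbb{R}^2)$ carries the inner product $\langle (f_1,f_2),(g_1,g_2)\rangle=\langle f_1,g_1\rangle_{L^2(S)}+\langle f_2,g_2\rangle_{L^2(S)}$. For a bounded interval $I$ and $f\in L^2(I)$, $\widetilde f\in L^2(\mathbb{R})$ denotes the extension of $f$ by $0$ outside $I$. For $y>0$, $x\in\mathbb{R}$, $P_y(x)=\frac{1}{\pi}\frac{y}{x^2+y^2}$ and $Q_y(x)=\frac{1}{\pi}\frac{x}{x^2+y^2}$; $\star$ is convolution in $x\in\mathbb{R}$. The bounded operator $b_2:L^2(S,\mathbb{R}^2)\to L^2(K)$ is $b_2[(m_1,m_2)]=-\left[\partial_x\left(P_h\star\widetilde{m_1}-Q_h\star\widetilde{m_2}\right)\right]_{|K}$, and its adjoint is $b_2^*:L^2(K)\to L^2(S,\mathbb{R}^2)$,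 $b_2^*[\phi]=\left(\partial_x(P_h\star\widetilde\phi)_{|S},\ \partial_x(Q_h\star\widetilde\phi)_{|S}\right)$. The minimizer $\phi_o$ exists and is unique.
   Formalization: The formal theorem assumes M > 0 instead of M ≥ 0: for M = 0 the minimizer is 0 and the equation becomes 0 = b_2[e], which no λ satisfies, since b_2 is injective and e ≠ 0. *)

theory Defs
  imports "HOL-Analysis.Analysis"
begin

text \<open>
  The elements of the Hilbert spaces \<open>L\<^sup>2(S)\<close> and \<open>L\<^sup>2(S, \<real>\<^sup>2)\<close> are represented by functions
  (for \<open>'a = real\<close> and \<open>'a = real \<times> real\<close>, respectively); only the values on \<open>S\<close> matter, and two
  functions represent the same element iff they are related by \<open>L2_eq S\<close>.
  The inner product of \<open>real \<times> real\<close> is the sum of the componentwise products, so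
  \<open>L2_inner\<close> on \<open>L\<^sup>2(S, \<real>\<^sup>2)\<close> is the sum of the inner products of the components.
\<close>

definition L2 :: "real set \<Rightarrow> (real \<Rightarrow> 'a::euclidean_space) set" where
  "L2 S = {f. f \<in> borel_measurable (lebesgue_on S) \<and> integrable (lebesgue_on S) (\<lambda>x. (norm (f x))\<^sup>2)}"

definition L2_eq :: "real set \<Rightarrow> (real \<Rightarrow> 'a::euclidean_space) \<Rightarrow> (real \<Rightarrow> 'a) \<Rightarrow> bool" where
  "L2_eq S f g \<longleftrightarrow> (AE x in lebesgue_on S. f x = g x)"

definition L2_inner :: "real set \<Rightarrow> (real \<Rightarrow> 'a::euclidean_space) \<Rightarrow> (real \<Rightarrow> 'a) \<Rightarrow> real" where
  "L2_inner S f g = (LINT x|lebesgue_on S. f x \<bullet> g x)"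

definition L2_norm :: "real set \<Rightarrow> (real \<Rightarrow> 'a::euclidean_space) \<Rightarrow> real" where
  "L2_norm S f = sqrt (L2_inner S f f)"

definition zero_ext :: "real set \<Rightarrow> (real \<Rightarrow> real) \<Rightarrow> real \<Rightarrow> real" where
  "zero_ext S f = (\<lambda>x. if x \<in> S then f x else 0)"

definition convolution :: "(real \<Rightarrow> real) \<Rightarrow> (real \<Rightarrow> real) \<Rightarrow> real \<Rightarrow> real" (infixl "\<star>" 70) where
  "f \<star> g = (\<lambda>x. LINT t|lebesgue. f (x - t) * g t)"

definition poisson_kernel :: "real \<Rightarrow> real \<Rightarrow> real" where
  "poisson_kernel y x = 1 / pi * (y / (x\<^sup>2 + y\<^sup>2))"

definition conj_poisson_kernel :: "real \<Rightarrow> real \<Rightarrow> real" where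
  "conj_poisson_kernel y x = 1 / pi * (x / (x\<^sup>2 + y\<^sup>2))"

definition b2 :: "real \<Rightarrow> real set \<Rightarrow> real set \<Rightarrow> (real \<Rightarrow> real \<times> real) \<Rightarrow> real \<Rightarrow> real" where
  "b2 h S K m = (\<lambda>x\<in>K. - deriv (\<lambda>y.
      (poisson_kernel h \<star> zero_ext S (\<lambda>t. fst (m t))) y
    - (conj_poisson_kernel h \<star> zero_ext S (\<lambda>t. snd (m t))) y) x)"

definition b2_adj :: "real \<Rightarrow> real set \<Rightarrow> real set \<Rightarrow> (real \<Rightarrow> real) \<Rightarrow> real \<Rightarrow> real \<times> real" where
  "b2_adj h S K \<phi> = (\<lambda>x\<in>S.
     (deriv (poisson_kernel h \<star> zero_ext K \<phi>) x, deriv (conj_poisson_kernel h \<star> zero_ext K \<phi>) x))"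

definition Ran_b2_adj :: "real \<Rightarrow> real set \<Rightarrow> real set \<Rightarrow> (real \<Rightarrow> real \<times> real) set" where
  "Ran_b2_adj h S K = {m \<in> L2 S. \<exists>\<phi>\<in>L2 K. L2_eq S (b2_adj h S K \<phi>) m}"

end

theory Submission
  imports Defs "HOL-Complex_Analysis.Complex_Analysis"
begin

text \<open>
  Put \<open>g = b\<^sub>2 (b\<^sub>2\<^sup>* \<phi>\<^sub>o - e)\<close>. Minimality along the segment from \<open>\<phi>\<^sub>o\<close> to \<open>- M g / \<parallel>g\<parallel>\<close> and the
  adjointness of \<open>b\<^sub>2\<close> and \<open>b\<^sub>2\<^sup>*\<close> give \<open>\<langle>g, \<phi>\<^sub>o\<rangle> \<le> - M \<parallel>g\<parallel>\<close>, which is the equality case of the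
  Cauchy--Schwarz inequality: \<open>\<phi>\<^sub>o = - M g / \<parallel>g\<parallel>\<close> and \<open>\<lambda> = \<parallel>g\<parallel> / M\<close>. This requires \<open>g \<noteq> 0\<close>, which
  follows from \<open>e \<notin> Ran b\<^sub>2\<^sup>*\<close> because \<open>b\<^sub>2\<close> is injective.

  For the injectivity, \<open>P\<^sub>h + \<i> Q\<^sub>h = (\<i> / \<pi>) / (x + \<i> h)\<close> shows that \<open>b\<^sub>2 m = 0\<close> means
  \<open>Im D (x + \<i> h) = 0\<close> on \<open>K\<close>, where \<open>D z = \<integral> (m\<^sub>1 + \<i> m\<^sub>2) t / (z - t)\<^sup>2 dt\<close>. Then \<open>D\<close> agrees with its
  reflection across the line \<open>Im z = h\<close> on \<open>0 < Im z < 2 h\<close>, so it extends to a bounded entire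
  function, which is constant by Liouville's theorem and vanishes because \<open>D (\<i> y) \<rightarrow> 0\<close>. Hence the
  Cauchy transform of \<open>m\<^sub>1 + \<i> m\<^sub>2\<close> vanishes for \<open>Im z \<ge> h\<close>, so all moments of \<open>m\<close> are zero (expand
  at infinity), and \<open>m = 0\<close> by the Weierstrass approximation theorem.
\<close>

section \<open>Cauchy transforms and moments\<close>

text \<open>Every kernel integral in this development is an integrable density times a bounded
  kernel, so this gives its existence and its size at once.\<close>

lemma integrable_mult_bounded:
  fixes m k :: "'a \<Rightarrow> 'b::{real_normed_field, banach, second_countable_topology}"
  assumes m: "integrable M m" and k: "k \<in> borel_measurable M" and B: "\<And>t. norm (k t) \<le> B"
  shows "integrable M (\<lambda>t. m t * k t)"
    and "norm (LINT t|M. m t * k t) \<le> B * (LINT t|M. norm (m t))"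
proof -
  have le: "norm (m t * k t) \<le> B * norm (m t)" for t
    using mult_left_mono[OF B[of t] norm_ge_zero[of "m t"]] by (simp add: norm_mult mult.commute)
  have B0: "0 \<le> B" using B[of undefined] norm_ge_zero order_trans by blast
  have dom: "integrable M (\<lambda>t. B * norm (m t))" using m by simp
  show i: "integrable M (\<lambda>t. m t * k t)"
    by (rule Bochner_Integration.integrable_bound[OF dom])
      (use m k le B0 in \<open>auto intro!: borel_measurable_times simp: abs_mult\<close>)
  have "norm (LINT t|M. m t * k t) \<le> (LINT t|M. norm (m t * k t))"
    by (rule integral_norm_bound)
  also have "\<dots> \<le> (LINT t|M. B * norm (m t))"
    by (rule integral_mono) (use i dom le in auto)
  finally show "norm (LINT t|M. m t * k t) \<le> B * (LINT t|M. norm (m t))" by simp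
qed

text \<open>Kept general in the field because it serves complex densities in
  \<open>moment_eq_0\<close> and real ones in \<open>moments_eq_0_imp_AE_eq_0\<close>.\<close>

lemma moment_integrable:
  fixes m :: "real \<Rightarrow> 'b::{real_normed_field, banach, second_countable_topology}"
  assumes [measurable]: "(\<lambda>t. t) \<in> borel_measurable M" and m: "integrable M m"
    and bdd: "\<And>t. t \<in> space M \<Longrightarrow> \<bar>t\<bar> \<le> r"
  shows "integrable M (\<lambda>t. m t * of_real t ^ n)"
proof (rule Bochner_Integration.integrable_bound)
  show "integrable M (\<lambda>t. \<bar>r\<bar> ^ n * norm (m t))" using m by simp
  have "norm (m t) * \<bar>t\<bar> ^ n \<le> \<bar>r\<bar> ^ n * norm (m t)" if "t \<in> space M" for t
    using bdd[OF that] by (subst mult.commute) (intro mult_right_mono power_mono, auto)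
  then show "AE t in M. norm (m t * of_real t ^ n) \<le> norm (\<bar>r\<bar> ^ n * norm (m t))"
    by (auto simp: norm_mult norm_power)
  have [measurable]: "m \<in> borel_measurable M" using m by simp
  show "(\<lambda>t. m t * of_real t ^ n) \<in> borel_measurable M" by measurable
qed

lemma Im_le_cmod_diff: "Im z \<le> cmod (z - complex_of_real t)"
  using abs_Im_le_cmod[of "z - complex_of_real t"] by simp

lemma cmod_inverse_diff_power_le:
  assumes "0 < d" "d \<le> Im z"
  shows "cmod (inverse ((z - complex_of_real t) ^ n)) \<le> 1 / d ^ n"
proof -
  have "d ^ n \<le> cmod (z - complex_of_real t) ^ n"
    using assms Im_le_cmod_diff[of z t] by (intro power_mono) auto
  then show ?thesis
    using assms by (simp add: norm_divide norm_power inverse_eq_divide frac_le)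
qed

section \<open>The Cauchy transform in the upper half-plane\<close>

context
  fixes M :: "real measure" and m :: "real \<Rightarrow> complex"
  assumes id_measurable [measurable]: "(\<lambda>t. t) \<in> borel_measurable M"
    and m: "integrable M m"
begin

lemma m_measurable [measurable]: "m \<in> borel_measurable M"
  using m by simp

lemma cauchy_power_integrable:
  assumes "0 < Im z"
  shows "integrable M (\<lambda>t. m t / (z - of_real t) ^ n)"
  unfolding divide_inverse
  by (rule integrable_mult_bounded(1)[OF m]) (use assms cmod_inverse_diff_power_le[of "Im z" z] in auto)

lemma cauchy_power_bound:
  assumes "0 < d" "d \<le> Im z"
  shows "cmod (LINT t|M. m t / (z - of_real t) ^ n) \<le> 1 / d ^ n * (LINT t|M. cmod (m t))"
  unfolding divide_inverse[of "m _"]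
  by (rule integrable_mult_bounded(2)[OF m]) (use assms cmod_inverse_diff_power_le[of d z] in auto)

text \<open>The error of the difference quotient is exactly \<open>w - z\<close> times the integral
  of \<open>m t / ((w - t) * (z - t)^2)\<close>, and this kernel is bounded uniformly in
  \<open>t\<close> for \<open>w\<close> near \<open>z\<close>.\<close>

lemma cauchy_transform_has_field_derivative:
  assumes z: "0 < Im z"
  shows "((\<lambda>z. LINT t|M. m t / (z - of_real t)) has_field_derivative
           - (LINT t|M. m t / (z - of_real t)\<^sup>2)) (at z)"
  unfolding has_field_derivative_iff
proof (rule LIM_zero_cancel, rule Lim_null_comparison)
  \<comment> \<open>For \<open>Im w > Im z / 2\<close> one has
    \<open>1 / cmod (w - t) \<le> 2 / Im z\<close>; the other two factors contribute
    \<open>1 / Im z ^ 2\<close>.\<close>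
  define C where "C = 2 / Im z ^ 3 * (LINT t|M. cmod (m t))"
  show "((\<lambda>w. cmod (w - z) * C) \<longlongrightarrow> 0) (at z)"
    by (auto intro!: tendsto_eq_intros)
  have "\<forall>\<^sub>F w in at z. w \<in> {w. Im z / 2 < Im w} - {z}"
    using z by (intro eventually_at_in_open open_halfspace_Im_gt) simp
  then show "\<forall>\<^sub>F w in at z. cmod (((LINT t|M. m t / (w - of_real t)) - (LINT t|M. m t / (z - of_real t))) / (w - z)
       - - (LINT t|M. m t / (z - of_real t)\<^sup>2)) \<le> cmod (w - z) * C"
  proof (rule eventually_mono)
    fix w assume "w \<in> {w. Im z / 2 < Im w} - {z}"
    then have w: "Im z / 2 \<le> Im w" "w \<noteq> z" "0 < Im w" using z by auto
    have nz: "w - of_real t \<noteq> 0" "z - of_real t \<noteq> 0" for t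
      using z w by (auto simp: complex_eq_iff)
    have i: "integrable M (\<lambda>t. m t / (w - of_real t))" "integrable M (\<lambda>t. m t / (z - of_real t))"
      "integrable M (\<lambda>t. m t / (z - of_real t)\<^sup>2)"
      using cauchy_power_integrable[of w 1] cauchy_power_integrable[of z 1]
        cauchy_power_integrable[of z 2] z w by auto
    have "((LINT t|M. m t / (w - of_real t)) - (LINT t|M. m t / (z - of_real t))) / (w - z)
       - - (LINT t|M. m t / (z - of_real t)\<^sup>2)
      = (LINT t|M. (m t / (w - of_real t) - m t / (z - of_real t)) / (w - z) + m t / (z - of_real t)\<^sup>2)"
      using i by simp
    also have "\<dots> = (LINT t|M. (w - z) * (m t * (inverse (w - of_real t) * inverse ((z - of_real t)\<^sup>2))))"
    proof (rule Bochner_Integration.integral_cong[OF refl])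
      fix t
      have "(m t / a - m t / b) / (a - b) + m t / b\<^sup>2 = (a - b) * (m t * (inverse a * inverse (b\<^sup>2)))"
        if "a \<noteq> 0" "b \<noteq> 0" "a \<noteq> b" for a b
      proof -
        have "(m t / a - m t / b) / (a - b) = - (m t / (a * b))"
          using that by (simp add: divide_simps) (simp add: algebra_simps)
        then show ?thesis
          using that by (simp add: divide_simps power2_eq_square) (simp add: algebra_simps)
      qed
      from this[of "w - of_real t" "z - of_real t"] nz w
      show "(m t / (w - of_real t) - m t / (z - of_real t)) / (w - z) + m t / (z - of_real t)\<^sup>2
        = (w - z) * (m t * (inverse (w - of_real t) * inverse ((z - of_real t)\<^sup>2)))"
        by simp
    qed
    also have "cmod \<dots> = cmod (w - z) * cmod (LINT t|M. m t * (inverse (w - of_real t) * inverse ((z - of_real t)\<^sup>2)))"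
      by (simp add: norm_mult)
    also have "\<dots> \<le> cmod (w - z) * C"
    proof (rule mult_left_mono)
      have "cmod (inverse (w - of_real t) * inverse ((z - of_real t)\<^sup>2)) \<le> 2 / Im z ^ 3" for t
      proof -
        have "cmod (inverse (w - of_real t)) * cmod (inverse ((z - of_real t)\<^sup>2)) \<le> (1 / (Im z / 2) ^ 1) * (1 / Im z ^ 2)"
          using cmod_inverse_diff_power_le[of "Im z / 2" w t 1] cmod_inverse_diff_power_le[of "Im z" z t 2] z w
          by (intro mult_mono) auto
        then show ?thesis by (simp add: norm_mult power3_eq_cube power2_eq_square mult.assoc)
      qed
      then show "cmod (LINT t|M. m t * (inverse (w - of_real t) * inverse ((z - of_real t)\<^sup>2))) \<le> C"
        unfolding C_def by (intro integrable_mult_bounded(2)[OF m]) auto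
    qed auto
    finally show "cmod (((LINT t|M. m t / (w - of_real t)) - (LINT t|M. m t / (z - of_real t))) / (w - z)
       - - (LINT t|M. m t / (z - of_real t)\<^sup>2)) \<le> cmod (w - z) * C" .
  qed
qed

text \<open>It is minus the derivative of the Cauchy transform, which is holomorphic by the previous
  lemma.\<close>

lemma cauchy_square_holomorphic:
  "(\<lambda>z. LINT t|M. m t / (z - of_real t)\<^sup>2) holomorphic_on {z. 0 < Im z}"
proof -
  let ?F = "\<lambda>z. LINT t|M. m t / (z - of_real t)"
  have o: "open {z. 0 < Im z}" by (simp add: open_halfspace_Im_gt)
  have "?F holomorphic_on {z. 0 < Im z}"
    using cauchy_transform_has_field_derivative o by (auto simp: holomorphic_on_open)
  then have "(\<lambda>z. - deriv ?F z) holomorphic_on {z. 0 < Im z}"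
    using o by (intro holomorphic_intros) auto
  then show ?thesis
    by (rule holomorphic_transform) (simp add: DERIV_imp_deriv[OF cauchy_transform_has_field_derivative])
qed

text \<open>\<open>D\<close> is already holomorphic across the line \<open>Im z = h\<close>, so its
  reflection is glued on by the identity theorem in a strip, and no boundary values have to be
  controlled.\<close>

lemma cauchy_transform_eq_0:
  assumes h: "0 < h" and K: "open K" "K \<noteq> {}"
    and Im0: "\<And>x. x \<in> K \<Longrightarrow> Im (LINT t|M. m t / (Complex x h - of_real t)\<^sup>2) = 0"
    and z: "h \<le> Im z"
  shows "(LINT t|M. m t / (z - of_real t)) = 0"
proof -
  define D where "D z = (LINT t|M. m t / (z - of_real t)\<^sup>2)" for z
  \<comment> \<open>The point \<open>cnj z + 2 * \<i> * h\<close> is the mirror image of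
    \<open>z\<close> in the line \<open>Im z = h\<close>; its height is \<open>2 * h - Im z\<close>.
    Written this way, \<open>R\<close> is a translate of
    \<open>cnj \<circ> D \<circ> cnj\<close>.\<close>
  define R where "R z = cnj (D (cnj (z + cnj (Complex 0 (2 * h)))))" for z
  define E where "E z = (if h \<le> Im z then D z else R z)" for z
  define C where "C = (LINT t|M. cmod (m t))"
  have Dh: "D holomorphic_on {z. 0 < Im z}"
    using cauchy_square_holomorphic by (simp add: D_def[abs_def])
  have o: "open {z. 0 < Im z}" "open {z. Im z < 2 * h}"
    by (simp_all add: open_halfspace_Im_gt open_halfspace_Im_lt)
  have "cnj \<circ> D \<circ> cnj holomorphic_on {z. Im z < 0}"
    by (rule holomorphic_on_compose_cnj_cnj)
      (auto intro: holomorphic_on_subset[OF Dh] simp: open_halfspace_Im_lt)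
  then have "(cnj \<circ> D \<circ> cnj) \<circ> (\<lambda>z. z + cnj (Complex 0 (2 * h))) holomorphic_on {z. Im z < 2 * h}"
    by (rule holomorphic_on_compose_gen[rotated]) (auto intro!: holomorphic_intros)
  then have Rh: "R holomorphic_on {z. Im z < 2 * h}"
    by (simp add: R_def[abs_def] o_def)
  define T where "T = {z. 0 < Im z} \<inter> {z. Im z < 2 * h}"
  \<comment> \<open>On the translate of \<open>K\<close> to height \<open>h\<close> the reflection
    fixes \<open>z\<close> and \<open>D\<close> is real. So \<open>D\<close> and \<open>R\<close>
    agree on a set that has a limit point in the connected strip \<open>T\<close>.\<close>
  have DR: "D z = R z" if "z \<in> T" for z
  proof -
    obtain x0 where x0: "x0 \<in> K" using K by auto
    define Z where "Z = (\<lambda>x. Complex x h) ` K"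
    have "D z - R z = 0"
    proof (rule analytic_continuation[where f = "\<lambda>z. D z - R z" and S = T and U = Z])
      show "(\<lambda>z. D z - R z) holomorphic_on T"
        unfolding T_def by (intro holomorphic_intros holomorphic_on_subset[OF Dh] holomorphic_on_subset[OF Rh]) auto
      show "open T" using o by (auto simp: T_def)
      show "connected T" unfolding T_def
        by (intro convex_connected convex_Int convex_halfspace_Im_gt convex_halfspace_Im_lt)
      show "Z \<subseteq> T" "Complex x0 h \<in> T" using h x0 by (auto simp: Z_def T_def)
      have "x0 islimpt K" using K x0 by (simp add: interior_limit_point interior_open)
      then show "Complex x0 h islimpt Z"
        unfolding islimpt_approachable Z_def
        by (auto simp: dist_norm cmod_def complex_diff)
      show "D z - R z = 0" if "z \<in> Z" for z
      proof -
        from that obtain x where x: "x \<in> K" "z = Complex x h" by (auto simp: Z_def)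
        have "cnj (z + cnj (Complex 0 (2 * h))) = z" using x by (simp add: complex_eq_iff)
        moreover have "cnj (D z) = D z" using Im0[of x] x(1) unfolding D_def x(2) by (simp add: complex_eq_iff)
        ultimately show ?thesis by (simp add: R_def)
      qed
    qed (rule that)
    then show ?thesis by simp
  qed
  have "E holomorphic_on {z. 0 < Im z} \<union> {z. Im z < 2 * h}"
  proof (rule holomorphic_on_Un[OF _ _ o])
    show "E holomorphic_on {z. 0 < Im z}"
      by (rule holomorphic_transform[OF Dh]) (use h DR in \<open>auto simp: E_def T_def\<close>)
    show "E holomorphic_on {z. Im z < 2 * h}"
      by (rule holomorphic_transform[OF Rh]) (use h DR in \<open>auto simp: E_def T_def\<close>)
  qed
  moreover have "{z. 0 < Im z} \<union> {z. Im z < 2 * h} = UNIV" using h by auto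
  ultimately have Eh: "E holomorphic_on UNIV" by simp
  have D_le: "cmod (D z) \<le> 1 / d\<^sup>2 * C" if "0 < d" "d \<le> Im z" for d z
    unfolding D_def C_def using cauchy_power_bound[OF that, of 2] .
  \<comment> \<open>In both branches \<open>D\<close> is evaluated at height at least
    \<open>h\<close>: for \<open>Im z < h\<close> the mirror image lies above the line.\<close>
  have "cmod (E z) \<le> 1 / h\<^sup>2 * C" for z
    using D_le[OF h, of z] D_le[OF h, of "cnj (z + cnj (Complex 0 (2 * h)))"] by (auto simp: E_def R_def)
  then have "bounded (range E)" by (auto simp: bounded_iff)
  then obtain c where c: "\<And>z. E z = c"
    using Liouville_theorem[OF Eh] by (auto simp: constant_on_def)
  have Dc: "D z = c" if "h \<le> Im z" for z using c[of z] that by (simp add: E_def)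
  \<comment> \<open>The constant is also the value of \<open>D\<close> at \<open>\<i> * y\<close>
    for every \<open>y \<ge> h\<close>, and this decays like \<open>1 / y^2\<close>.\<close>
  have "c = 0"
  proof (rule ccontr)
    assume "c \<noteq> 0"
    have lim: "((\<lambda>y. 1 / y\<^sup>2 * C) \<longlongrightarrow> 0) at_top" by real_asymp
    have "\<forall>\<^sub>F y in at_top. cmod c \<le> 1 / y\<^sup>2 * C"
      using eventually_ge_at_top[of h]
    proof eventually_elim
      case (elim y)
      then show ?case using D_le[of y "Complex 0 y"] Dc[of "Complex 0 y"] h by simp
    qed
    from tendsto_lowerbound[OF lim this] \<open>c \<noteq> 0\<close> show False by simp
  qed
  \<comment> \<open>The Cauchy transform has derivative \<open>- D = 0\<close> on a convex
    half-plane; its decay like \<open>1 / y\<close> then excludes a nonzero constant.\<close>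
  have "\<exists>c. \<forall>z\<in>{z. h \<le> Im z}. (LINT t|M. m t / (z - of_real t)) = c"
  proof (rule has_field_derivative_zero_constant)
    show "convex {z. h \<le> Im z}" by (rule convex_halfspace_Im_ge)
    show "((\<lambda>z. LINT t|M. m t / (z - of_real t)) has_field_derivative 0) (at z within {z. h \<le> Im z})"
      if "z \<in> {z. h \<le> Im z}" for z
      using cauchy_transform_has_field_derivative[of z] Dc[of z] that h \<open>c = 0\<close>
      by (auto simp: D_def intro: has_field_derivative_at_within)
  qed
  then obtain c' where c': "\<And>z. h \<le> Im z \<Longrightarrow> (LINT t|M. m t / (z - of_real t)) = c'" by auto
  have "c' = 0"
  proof (rule ccontr)
    assume "c' \<noteq> 0"
    have lim: "((\<lambda>y. 1 / y * C) \<longlongrightarrow> 0) at_top" by real_asymp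
    have "\<forall>\<^sub>F y in at_top. cmod c' \<le> 1 / y * C"
      using eventually_ge_at_top[of h]
    proof eventually_elim
      case (elim y)
      then show ?case using cauchy_power_bound[of y "Complex 0 y" 1] c'[of "Complex 0 y"] h by (simp add: C_def)
    qed
    from tendsto_lowerbound[OF lim this] \<open>c' \<noteq> 0\<close> show False by simp
  qed
  then show ?thesis using c' z by simp
qed

text \<open>The expansion at infinity is carried out one coefficient at a time. If the transform of
  \<open>m t * t^n\<close> vanishes at all \<open>\<i> * y\<close> with \<open>y \<ge> h\<close>,
  multiplying by \<open>\<i> * y\<close> and letting \<open>y\<close> grow shows that the
  \<open>n\<close>-th moment is zero; then the transform of \<open>m t * t^(n+1)\<close> vanishes
  there too.\<close>

lemma moment_eq_0:
  assumes h: "0 < h" and bdd: "\<And>t. t \<in> space M \<Longrightarrow> \<bar>t\<bar> \<le> r"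
    and F0: "\<And>y. h \<le> y \<Longrightarrow> (LINT t|M. m t / (Complex 0 y - of_real t)) = 0"
  shows "(LINT t|M. m t * of_real t ^ n) = 0"
proof -
  note int = moment_integrable[OF id_measurable m bdd]
  have nz: "Complex 0 y - of_real t \<noteq> 0" if "h \<le> y" for y t
    using that h by (auto simp: complex_eq_iff)
  have quot: "integrable M (\<lambda>t. m t * of_real t ^ n / (Complex 0 y - of_real t))" if "h \<le> y" for n y
    unfolding divide_inverse
    by (rule integrable_mult_bounded(1)[OF int, where B = "1 / h ^ 1"])
      (use that h cmod_inverse_diff_power_le[of h "Complex 0 y" _ 1] in auto)
  have step: "(LINT t|M. m t * of_real t ^ n) = 0"
    if *: "\<And>y. h \<le> y \<Longrightarrow> (LINT t|M. m t * of_real t ^ n / (Complex 0 y - of_real t)) = 0" for n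
  proof -
    \<comment> \<open>Dominated convergence applies because
      \<open>cmod (\<i> * y / (\<i> * y - t)) \<le> 1\<close> for real \<open>t\<close>.\<close>
    have "((\<lambda>y. LINT t|M. Complex 0 y * (m t * of_real t ^ n / (Complex 0 y - of_real t)))
        \<longlongrightarrow> (LINT t|M. m t * of_real t ^ n)) at_top"
    proof (rule integral_dominated_convergence_at_top)
      show "integrable M (\<lambda>t. cmod (m t * of_real t ^ n))" using int by simp
      show "\<forall>\<^sub>F y in at_top. AE t in M. cmod (Complex 0 y * (m t * of_real t ^ n / (Complex 0 y - of_real t)))
            \<le> cmod (m t * of_real t ^ n)"
        using eventually_ge_at_top[of h]
      proof eventually_elim
        case (elim y)
        have "cmod (Complex 0 y) / cmod (Complex 0 y - of_real t) \<le> 1" for t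
          using Im_le_cmod_diff[of "Complex 0 y" t] nz[OF elim, of t] h elim
          by (simp add: divide_le_eq_1) (simp add: cmod_def)
        then have "cmod (m t * of_real t ^ n) * (cmod (Complex 0 y) / cmod (Complex 0 y - of_real t))
           \<le> cmod (m t * of_real t ^ n) * 1" for t
          by (rule mult_left_mono) simp
        then show ?case by (simp add: norm_mult norm_divide mult_ac)
      qed
      show "AE t in M. ((\<lambda>y. Complex 0 y * (m t * of_real t ^ n / (Complex 0 y - of_real t)))
            \<longlongrightarrow> m t * of_real t ^ n) at_top"
      proof (intro AE_I2)
        fix t
        \<comment> \<open>The factor \<open>\<i> * y / (\<i> * y - t)\<close> equals
          \<open>1 / (1 + \<i> * t / y)\<close>, whose limit is visibly 1.\<close>
        have "((\<lambda>y. inverse (of_real y) * (\<i> * complex_of_real t)) \<longlongrightarrow> 0 * (\<i> * complex_of_real t)) at_top"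
          using tendsto_of_real[OF tendsto_inverse_0_at_top[OF filterlim_ident], where 'a = complex]
          by (intro tendsto_mult_right) (simp del: tendsto_of_real_iff)
        then have "((\<lambda>y. m t * of_real t ^ n * inverse (1 + inverse (of_real y) * (\<i> * complex_of_real t)))
           \<longlongrightarrow> m t * of_real t ^ n * inverse (1 + 0 * (\<i> * complex_of_real t))) at_top"
          by (intro tendsto_mult[OF tendsto_const] tendsto_inverse tendsto_add[OF tendsto_const]) auto
        then have lim: "((\<lambda>y. m t * of_real t ^ n * inverse (1 + inverse (of_real y) * (\<i> * complex_of_real t)))
           \<longlongrightarrow> m t * of_real t ^ n) at_top" by simp
        show "((\<lambda>y. Complex 0 y * (m t * of_real t ^ n / (Complex 0 y - of_real t)))
            \<longlongrightarrow> m t * of_real t ^ n) at_top"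
        proof (rule Lim_transform_eventually[OF lim])
          show "\<forall>\<^sub>F y in at_top. m t * of_real t ^ n * inverse (1 + inverse (of_real y) * (\<i> * complex_of_real t))
              = Complex 0 y * (m t * of_real t ^ n / (Complex 0 y - of_real t))"
            using eventually_ge_at_top[of h]
          proof eventually_elim
            case (elim y)
            have "1 + inverse (of_real y) * (\<i> * complex_of_real t) = (Complex 0 y - of_real t) / Complex 0 y"
              using elim h by (simp add: Complex_eq divide_simps) (simp add: algebra_simps)
            then show ?case by (simp add: field_simps)
          qed
        qed
      qed
    qed measurable
    moreover have "\<forall>\<^sub>F y in at_top. (LINT t|M. Complex 0 y * (m t * of_real t ^ n / (Complex 0 y - of_real t))) = 0"
      using eventually_ge_at_top[of h] by eventually_elim (simp only: integral_mult_right_zero * mult_zero_right)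
    ultimately have "((\<lambda>y::real. 0) \<longlongrightarrow> (LINT t|M. m t * of_real t ^ n)) at_top"
      by (rule Lim_transform_eventually)
    then show ?thesis by (simp add: tendsto_const_iff)
  qed
  have "\<forall>y\<ge>h. (LINT t|M. m t * of_real t ^ n / (Complex 0 y - of_real t)) = 0"
  proof (induction n)
    case 0
    then show ?case using F0 by simp
  next
    case (Suc n)
    show ?case
    proof (intro allI impI)
      fix y assume y: "h \<le> y"
      \<comment> \<open>Writing one factor \<open>t\<close> as
        \<open>\<i> * y - (\<i> * y - t)\<close> expresses the next transform through the current
        transform and the current moment, both of which are zero.\<close>
      have "m t * of_real t ^ Suc n / (Complex 0 y - of_real t)
          = Complex 0 y * (m t * of_real t ^ n / (Complex 0 y - of_real t)) - m t * of_real t ^ n" for t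
        using nz[OF y, of t] by (simp add: divide_simps) (simp add: algebra_simps)
      then have "(LINT t|M. m t * of_real t ^ Suc n / (Complex 0 y - of_real t))
        = Complex 0 y * (LINT t|M. m t * of_real t ^ n / (Complex 0 y - of_real t)) - (LINT t|M. m t * of_real t ^ n)"
        by (simp only: Bochner_Integration.integral_diff[OF integrable_mult_right[OF quot[OF y]] int]
            integral_mult_right_zero)
      then show "(LINT t|M. m t * of_real t ^ Suc n / (Complex 0 y - of_real t)) = 0"
        using Suc y step[of n] by simp
    qed
  qed
  then show ?thesis using step by blast
qed

end

section \<open>From vanishing moments to a vanishing function\<close>

lemma open_lebesgue: "open S \<Longrightarrow> S \<in> sets lebesgue"
  by auto

lemma id_lebesgue_on [measurable]: "(\<lambda>t. t) \<in> borel_measurable (lebesgue_on S)"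
  using id_borel_measurable_lebesgue_on[of S] by (simp add: id_def)

text \<open>Vanishing moments annihilate polynomials, hence, by Weierstrass on
  \<open>{-r..r}\<close>, bounded continuous functions. Approximating \<open>sgn u\<close> by these
  yields that the integral of \<open>\<bar>u\<bar>\<close> is zero; choosing \<open>sgn u\<close> as
  the target keeps the argument valid for \<open>u\<close> that is merely integrable.\<close>

lemma moments_eq_0_imp_AE_eq_0:
  fixes u :: "real \<Rightarrow> real"
  assumes S: "S \<in> sets lebesgue" and bdd: "\<And>t. t \<in> S \<Longrightarrow> \<bar>t\<bar> \<le> r"
    and u: "integrable (lebesgue_on S) u"
    and mom: "\<And>n. (LINT t|lebesgue_on S. u t * t ^ n) = 0"
  shows "AE t in lebesgue_on S. u t = 0"
proof -
  have um [measurable]: "u \<in> borel_measurable (lebesgue_on S)" using u by simp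
  have cm: "g \<in> borel_measurable (lebesgue_on S)" if "continuous_on UNIV g" for g :: "real \<Rightarrow> real"
    using measurable_compose[OF id_lebesgue_on borel_measurable_continuous_onI[OF that]] by simp
  define C where "C = (LINT t|lebesgue_on S. \<bar>u t\<bar>)"
  have zero: "(LINT t|lebesgue_on S. u t * g t) = 0"
    if g: "continuous_on UNIV g" and gB: "\<And>x. \<bar>g x\<bar> \<le> 1" for g
  proof -
    have ug: "integrable (lebesgue_on S) (\<lambda>t. u t * g t)"
      using integrable_mult_bounded(1)[OF u cm[OF g], of 1] gB by simp
    \<comment> \<open>With a polynomial \<open>p\<close> within \<open>\<epsilon>\<close> of
      \<open>g\<close> on \<open>{-r..r}\<close>, which contains \<open>S\<close>, the integral of
      \<open>u * g\<close> equals that of \<open>u * (g - p)\<close>.\<close>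
    have "\<bar>LINT t|lebesgue_on S. u t * g t\<bar> \<le> \<epsilon> * C" if \<epsilon>: "0 < \<epsilon>" for \<epsilon>
    proof -
      obtain p where p: "real_polynomial_function p" "\<And>x. x \<in> {-r..r} \<Longrightarrow> \<bar>g x - p x\<bar> < \<epsilon>"
        using Stone_Weierstrass_real_polynomial_function[of "{-r..r}" g \<epsilon>] \<epsilon> g
        by (metis compact_Icc continuous_on_subset subset_UNIV)
      obtain a n where an: "p = (\<lambda>x. \<Sum>i\<le>n. a i * x ^ i)"
        using p(1) real_polynomial_function_iff_sum by auto
      have mon: "integrable (lebesgue_on S) (\<lambda>t. u t * t ^ i)" for i
        using moment_integrable[OF id_lebesgue_on u, of r i] bdd by simp
      have up: "u t * p t = (\<Sum>i\<le>n. a i * (u t * t ^ i))" for t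
        by (simp add: an sum_distrib_left mult_ac)
      have upi: "integrable (lebesgue_on S) (\<lambda>t. u t * p t)"
        unfolding up using mon by auto
      have "(LINT t|lebesgue_on S. u t * p t) = 0"
        unfolding up using mon mom by (subst Bochner_Integration.integral_sum) auto
      then have "\<bar>LINT t|lebesgue_on S. u t * g t\<bar> = \<bar>LINT t|lebesgue_on S. u t * g t - u t * p t\<bar>"
        using ug upi by simp
      also have "\<dots> \<le> (LINT t|lebesgue_on S. \<bar>u t * g t - u t * p t\<bar>)"
        by (rule integral_abs_bound)
      also have "\<dots> \<le> (LINT t|lebesgue_on S. \<epsilon> * \<bar>u t\<bar>)"
      proof (rule integral_mono)
        fix t assume "t \<in> space (lebesgue_on S)"
        then have "\<bar>t\<bar> \<le> r" using bdd by simp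
        then have "\<bar>g t - p t\<bar> \<le> \<epsilon>" using p(2)[of t] by (auto simp: abs_le_iff)
        then have "\<bar>g t - p t\<bar> * \<bar>u t\<bar> \<le> \<epsilon> * \<bar>u t\<bar>" by (rule mult_right_mono) simp
        then show "\<bar>u t * g t - u t * p t\<bar> \<le> \<epsilon> * \<bar>u t\<bar>"
          by (simp add: abs_mult flip: right_diff_distrib) (simp add: mult.commute)
      qed (use ug upi u in auto)
      finally show ?thesis by (simp add: C_def)
    qed
    then have le: "\<bar>LINT t|lebesgue_on S. u t * g t\<bar> \<le> \<epsilon> * C" if "0 < \<epsilon>" for \<epsilon> using that .
    have "((\<lambda>\<epsilon>. \<epsilon> * C) \<longlongrightarrow> 0) (at_right 0)" by (auto intro!: tendsto_eq_intros)
    moreover have "\<forall>\<^sub>F \<epsilon> in at_right 0. \<bar>LINT t|lebesgue_on S. u t * g t\<bar> \<le> \<epsilon> * C"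
      using le eventually_at_right_less[of 0] by (rule eventually_mono[rotated])
    ultimately have "\<bar>LINT t|lebesgue_on S. u t * g t\<bar> \<le> 0"
      by (rule tendsto_lowerbound) simp
    then show ?thesis by simp
  qed
  \<comment> \<open>Test \<open>u\<close> against bounded continuous functions converging a.e. to \<open>sgn u\<close>.\<close>
  have "(\<lambda>t. sgn (u t)) \<in> borel_measurable (lebesgue_on S)" by measurable
  then have "(\<lambda>t. sgn (u t)) measurable_on S"
    using measurable_on_iff_borel_measurable[OF S] by blast
  then obtain N g where N: "negligible N" and g: "\<And>n::nat. continuous_on UNIV (g n)"
    and lim: "\<And>x. x \<notin> N \<Longrightarrow> (\<lambda>n. g n x) \<longlonglongrightarrow> (if x \<in> S then sgn (u x) else 0)"
    unfolding measurable_on_def by auto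
  \<comment> \<open>The approximants \<open>g n\<close> need not be bounded. Clamping them to the
    interval from -1 to 1 makes \<open>\<bar>u\<bar>\<close> a dominating function and leaves the
    limit \<open>sgn u\<close> unchanged.\<close>
  define c where "c n x = max (-1) (min 1 (g n x))" for n x
  have cc: "continuous_on UNIV (c n)" for n
    unfolding c_def[abs_def] using g by (intro continuous_intros)
  have cB: "\<bar>c n x\<bar> \<le> 1" for n x by (auto simp: c_def)
  have AEN: "AE x in lebesgue_on S. x \<in> S \<and> x \<notin> N"
    using N S by (auto simp: AE_restrict_space_iff negligible_iff_null_sets dest: AE_not_in)
  have "(\<lambda>n. LINT t|lebesgue_on S. u t * c n t) \<longlonglongrightarrow> (LINT t|lebesgue_on S. \<bar>u t\<bar>)"
  proof (rule integral_dominated_convergence[where w = "\<lambda>t. \<bar>u t\<bar>"])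
    show "AE x in lebesgue_on S. (\<lambda>n. u x * c n x) \<longlonglongrightarrow> \<bar>u x\<bar>"
      using AEN
    proof eventually_elim
      case (elim x)
      then have "(\<lambda>n. g n x) \<longlonglongrightarrow> sgn (u x)" using lim[of x] by simp
      then have "(\<lambda>n. u x * c n x) \<longlonglongrightarrow> u x * max (-1) (min 1 (sgn (u x)))"
        unfolding c_def by (intro tendsto_intros)
      moreover have "u x * max (-1) (min 1 (sgn (u x))) = \<bar>u x\<bar>" by (simp add: sgn_if)
      ultimately show ?case by simp
    qed
    show "AE x in lebesgue_on S. norm (u x * c n x) \<le> \<bar>u x\<bar>" for n
      using cB[of n] by (auto simp: abs_mult intro!: mult_left_le)
    show "(\<lambda>t. u t * c n t) \<in> borel_measurable (lebesgue_on S)" for n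
      using cm[OF cc[of n]] by measurable
  qed (use u in auto)
  then have "(LINT t|lebesgue_on S. \<bar>u t\<bar>) = 0"
    using zero[OF cc cB] by (simp add: tendsto_const_iff)
  then show ?thesis
    using u by (subst (asm) integral_nonneg_eq_0_iff_AE) auto
qed

section \<open>Square-integrable functions\<close>

lemma L2_measurable [measurable_dest]: "f \<in> L2 S \<Longrightarrow> f \<in> borel_measurable (lebesgue_on S)"
  and L2_square_integrable: "f \<in> L2 S \<Longrightarrow> integrable (lebesgue_on S) (\<lambda>x. (norm (f x))\<^sup>2)"
  by (simp_all add: L2_def)

lemma L2_inner_integrable:
  assumes [measurable]: "f \<in> L2 S" "g \<in> L2 S"
  shows "integrable (lebesgue_on S) (\<lambda>x. f x \<bullet> g x)"
proof (rule Bochner_Integration.integrable_bound)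
  show "integrable (lebesgue_on S) (\<lambda>x. (norm (f x))\<^sup>2 + (norm (g x))\<^sup>2)"
    using assms by (auto intro: L2_square_integrable)
  have "\<bar>f x \<bullet> g x\<bar> \<le> (norm (f x))\<^sup>2 + (norm (g x))\<^sup>2" for x
  proof -
    have "\<bar>f x \<bullet> g x\<bar> \<le> norm (f x) * norm (g x)" by (rule Cauchy_Schwarz_ineq2)
    also have "\<dots> \<le> 2 * norm (f x) * norm (g x)" by (simp add: mult.assoc)
    also have "\<dots> \<le> (norm (f x))\<^sup>2 + (norm (g x))\<^sup>2" by (rule sum_squares_bound)
    finally show ?thesis .
  qed
  then show "AE x in lebesgue_on S. norm (f x \<bullet> g x) \<le> norm ((norm (f x))\<^sup>2 + (norm (g x))\<^sup>2)"
    by (auto intro: order_trans)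
qed measurable

lemma L2_add:
  assumes f [measurable]: "f \<in> L2 S" and g [measurable]: "g \<in> L2 S"
  shows "(\<lambda>x. f x + g x) \<in> L2 S"
proof -
  have "integrable (lebesgue_on S) (\<lambda>x. f x \<bullet> f x + 2 * (f x \<bullet> g x) + g x \<bullet> g x)"
    using f g by (intro Bochner_Integration.integrable_add integrable_mult_right L2_inner_integrable)
  then show ?thesis
    unfolding L2_def by (auto simp: power2_norm_eq_inner inner_add_left inner_add_right inner_commute add_ac)
qed

lemma L2_scaleR: "f \<in> L2 S \<Longrightarrow> (\<lambda>x. c *\<^sub>R f x) \<in> L2 S"
  by (auto simp: L2_def power_mult_distrib)

lemma L2_diff: "f \<in> L2 S \<Longrightarrow> g \<in> L2 S \<Longrightarrow> (\<lambda>x. f x - g x) \<in> L2 S"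
  using L2_add[of f S "\<lambda>x. (-1) *\<^sub>R g x"] L2_scaleR[of g S "-1"] by simp

text \<open>The quadratic expansion behind both the first variation of the functional and the
  equality case of Cauchy-Schwarz.\<close>

lemma L2_inner_add_scaleR:
  assumes "f \<in> L2 S" "g \<in> L2 S"
  shows "L2_inner S (\<lambda>x. f x + c *\<^sub>R g x) (\<lambda>x. f x + c *\<^sub>R g x)
    = L2_inner S f f + 2 * c * L2_inner S f g + c\<^sup>2 * L2_inner S g g"
proof -
  have "(f x + c *\<^sub>R g x) \<bullet> (f x + c *\<^sub>R g x) = f x \<bullet> f x + 2 * c * (f x \<bullet> g x) + c\<^sup>2 * (g x \<bullet> g x)" for x
    by (simp add: inner_add_left inner_add_right inner_commute power2_eq_square)
  then show ?thesis
    unfolding L2_inner_def using assms by (simp add: L2_inner_integrable)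
qed

lemma L2_inner_nonneg: "0 \<le> L2_inner S f f"
  by (simp add: L2_inner_def)

lemma L2_norm_nonneg: "0 \<le> L2_norm S f"
  by (simp add: L2_norm_def L2_inner_nonneg)

lemma L2_norm_power2: "(L2_norm S f)\<^sup>2 = L2_inner S f f"
  by (simp add: L2_norm_def L2_inner_nonneg)

lemma L2_inner_eq_0_imp_AE:
  assumes "f \<in> L2 S" "L2_inner S f f = 0"
  shows "AE x in lebesgue_on S. f x = 0"
  using assms unfolding L2_inner_def
  by (subst (asm) integral_nonneg_eq_0_iff_AE) (auto simp: L2_inner_integrable)

text \<open>\<open>b2\<close> and \<open>b2_adj\<close> are \<open>undefined\<close> off
  \<open>K\<close> and \<open>S\<close>, so membership has to transfer along equality on the set
  alone.\<close>

lemma L2_cong: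
  assumes "\<And>x. x \<in> S \<Longrightarrow> f x = g x"
  shows "f \<in> L2 S \<longleftrightarrow> g \<in> L2 S"
proof -
  have "f \<in> borel_measurable (lebesgue_on S) \<longleftrightarrow> g \<in> borel_measurable (lebesgue_on S)"
    by (rule measurable_cong) (simp add: assms)
  moreover have "integrable (lebesgue_on S) (\<lambda>x. (norm (f x))\<^sup>2) \<longleftrightarrow> integrable (lebesgue_on S) (\<lambda>x. (norm (g x))\<^sup>2)"
    by (rule Bochner_Integration.integrable_cong) (auto simp: assms)
  ultimately show ?thesis by (simp add: L2_def)
qed

lemma L2_inner_cong:
  assumes "\<And>x. x \<in> S \<Longrightarrow> f x = f' x" "\<And>x. x \<in> S \<Longrightarrow> g x = g' x"
  shows "L2_inner S f g = L2_inner S f' g'"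
  unfolding L2_inner_def by (rule Bochner_Integration.integral_cong) (auto simp: assms)

lemma finite_measure_lebesgue_on_bounded_open:
  assumes "open S" "bounded S"
  shows "finite_measure (lebesgue_on S)"
  using assms by (intro finite_measure_lebesgue_on bounded_set_imp_lmeasurable) auto

lemma L2_integrable:
  assumes f [measurable]: "f \<in> L2 S" and S: "open S" "bounded S"
  shows "integrable (lebesgue_on S) f"
proof -
  interpret finite_measure "lebesgue_on S" by (rule finite_measure_lebesgue_on_bounded_open[OF S])
  show ?thesis
  proof (rule Bochner_Integration.integrable_bound)
    show "integrable (lebesgue_on S) (\<lambda>x. (norm (f x))\<^sup>2 + 1)"
      using L2_square_integrable[OF f] by simp
    have "norm (f x) \<le> (norm (f x))\<^sup>2 + 1" for x
      using sum_squares_bound[of "norm (f x)" 1] by (simp add: power2_eq_square) (smt (verit) norm_ge_zero)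
    then show "AE x in lebesgue_on S. norm (f x) \<le> norm ((norm (f x))\<^sup>2 + 1)"
      by (auto intro: order_trans)
  qed measurable
qed

lemma continuous_bounded_L2:
  fixes f :: "real \<Rightarrow> 'a::euclidean_space"
  assumes f: "continuous_on S f" and B: "\<And>x. x \<in> S \<Longrightarrow> norm (f x) \<le> B" and S: "open S" "bounded S"
  shows "f \<in> L2 S"
proof -
  interpret finite_measure "lebesgue_on S" by (rule finite_measure_lebesgue_on_bounded_open[OF S])
  have fm [measurable]: "f \<in> borel_measurable (lebesgue_on S)"
    using f S by (intro continuous_imp_measurable_on_sets_lebesgue) auto
  have "integrable (lebesgue_on S) (\<lambda>x. (norm (f x))\<^sup>2)"
  proof (rule integrable_const_bound[where B = "B\<^sup>2"])
    show "AE x in lebesgue_on S. norm ((norm (f x))\<^sup>2) \<le> B\<^sup>2"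
      using B by (intro AE_I2) (auto intro!: power_mono)
  qed measurable
  then show ?thesis by (simp add: L2_def)
qed

section \<open>The Poisson kernels\<close>

text \<open>\<open>P\<^sub>h + \<i> Q\<^sub>h = (\<i> / \<pi>) / (x + \<i> h)\<close>; this is its derivative.\<close>

definition dkernel :: "real \<Rightarrow> real \<Rightarrow> complex" where
  "dkernel h x = - (\<i> / of_real pi) / (Complex x h)\<^sup>2"

text \<open>This symmetry exchanges the roles of the two variables and thereby turns the kernel of
  \<open>b2\<close> into that of \<open>b2_adj\<close>.\<close>

lemma dkernel_uminus: "dkernel h (- x) = - cnj (dkernel h x)"
proof -
  have "(Complex (- x) h)\<^sup>2 = cnj ((Complex x h)\<^sup>2)"
    by (simp add: complex_eq_iff power2_eq_square)
  then show ?thesis by (simp add: dkernel_def)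
qed

text \<open>Translates kernel integrals over the real line into the squared Cauchy kernel on
  \<open>Im z = h\<close>, where the half-plane results apply.\<close>

lemma dkernel_eq: "m * dkernel h (x - t) = - (\<i> / of_real pi) * (m / (Complex x h - of_real t)\<^sup>2)"
proof -
  have "Complex (x - t) h = Complex x h - of_real t" by (simp add: complex_eq_iff)
  then show ?thesis by (simp add: dkernel_def)
qed

lemma poisson_kernel_eq: "0 < h \<Longrightarrow> poisson_kernel h x = Re (\<i> / of_real pi / Complex x h)"
  and conj_poisson_kernel_eq: "0 < h \<Longrightarrow> conj_poisson_kernel h x = Im (\<i> / of_real pi / Complex x h)"
proof -
  have eq: "\<i> / of_real pi / Complex x h = (\<i> / Complex x h) / of_real pi" by simp
  show "0 < h \<Longrightarrow> poisson_kernel h x = Re (\<i> / of_real pi / Complex x h)"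
    and "0 < h \<Longrightarrow> conj_poisson_kernel h x = Im (\<i> / of_real pi / Complex x h)"
    unfolding eq Re_divide_of_real Im_divide_of_real
    by (simp_all add: poisson_kernel_def conj_poisson_kernel_def Re_divide Im_divide)
qed

lemma convolution_zero_ext:
  assumes "S \<in> sets lebesgue"
  shows "(f \<star> zero_ext S g) x = (LINT t|lebesgue_on S. f (x - t) * g t)"
proof -
  have "(f \<star> zero_ext S g) x = (LINT t|lebesgue. (if t \<in> S then f (x - t) * g t else 0))"
    unfolding convolution_def zero_ext_def by (rule Bochner_Integration.integral_cong) auto
  then show ?thesis using assms by (simp add: Lebesgue_Measure.integral_restrict_UNIV)
qed

section \<open>Kernel integrals along the line \<open>Im z = h\<close>\<close>

context
  fixes h :: real
  assumes h: "0 < h"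
begin

lemma cmod_dkernel_le: "cmod (dkernel h x) \<le> 1 / (pi * h\<^sup>2)"
proof -
  have "h\<^sup>2 \<le> cmod (Complex x h) ^ 2" using h by (simp add: cmod_power2)
  then show ?thesis using h by (simp add: dkernel_def norm_divide norm_mult norm_power frac_le)
qed

lemma continuous_on_dkernel: "continuous_on A (dkernel h)"
proof -
  have "of_real x + \<i> * of_real h \<noteq> 0" for x using h by (simp add: complex_eq_iff)
  then show ?thesis unfolding dkernel_def[abs_def] Complex_eq by (intro continuous_intros) auto
qed

lemma dkernel_measurable [measurable]: "dkernel h \<in> borel_measurable borel"
  using continuous_on_dkernel by (rule borel_measurable_continuous_onI)

context
  fixes S :: "real set"
  assumes S: "open S" "bounded S"
begin

lemma integrable_dkernel:
  assumes "integrable (lebesgue_on S) m"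
  shows "integrable (lebesgue_on S) (\<lambda>t. m t * dkernel h (x - t))"
    and "cmod (LINT t|lebesgue_on S. m t * dkernel h (x - t)) \<le> 1 / (pi * h\<^sup>2) * (LINT t|lebesgue_on S. cmod (m t))"
  using integrable_mult_bounded[OF assms _ cmod_dkernel_le] by measurable

text \<open>Chain rule for the Cauchy transform along \<open>x \<mapsto> Complex x h\<close>; the
  differentiation under the integral was already done in the complex variable.\<close>

lemma cauchy_transform_line_derivative:
  assumes m: "integrable (lebesgue_on S) m"
  shows "((\<lambda>x. LINT t|lebesgue_on S. m t * (\<i> / of_real pi / Complex (x - t) h)) has_vector_derivative
     (LINT t|lebesgue_on S. m t * dkernel h (x - t))) (at x)"
proof -
  let ?F = "\<lambda>z. LINT t|lebesgue_on S. m t / (z - of_real t)"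
  have "(?F has_field_derivative - (LINT t|lebesgue_on S. m t / (Complex x h - of_real t)\<^sup>2)) (at (Complex x h))"
    using cauchy_transform_has_field_derivative[OF id_lebesgue_on m, of "Complex x h"] h by simp
  moreover have "((\<lambda>x. Complex x h) has_vector_derivative 1) (at x)"
    unfolding Complex_eq by (auto intro!: derivative_eq_intros)
  ultimately have "(?F \<circ> (\<lambda>x. Complex x h) has_vector_derivative
      1 * - (LINT t|lebesgue_on S. m t / (Complex x h - of_real t)\<^sup>2)) (at x)"
    by (intro field_vector_diff_chain_at) auto
  then have "((\<lambda>x. (\<i> / of_real pi) * ?F (Complex x h)) has_vector_derivative
      (\<i> / of_real pi) * - (LINT t|lebesgue_on S. m t / (Complex x h - of_real t)\<^sup>2)) (at x)"
    by (intro has_vector_derivative_mult_right) (simp add: o_def)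
  moreover have "(\<i> / of_real pi) * ?F (Complex x h) = (LINT t|lebesgue_on S. m t * (\<i> / of_real pi / Complex (x - t) h))" for x
    by (subst integral_mult_right_zero[symmetric], rule Bochner_Integration.integral_cong)
      (simp_all add: Complex_eq algebra_simps)
  moreover have "(\<i> / of_real pi) * - (LINT t|lebesgue_on S. m t / (Complex x h - of_real t)\<^sup>2)
      = (LINT t|lebesgue_on S. m t * dkernel h (x - t))"
    unfolding dkernel_eq integral_mult_right_zero by simp
  ultimately show ?thesis by simp
qed

lemma continuous_on_dkernel_transform:
  assumes m: "integrable (lebesgue_on S) m"
  shows "continuous_on A (\<lambda>x. LINT t|lebesgue_on S. m t * dkernel h (x - t))"
proof -
  let ?D = "\<lambda>z. LINT t|lebesgue_on S. m t / (z - of_real t)\<^sup>2"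
  have "continuous_on {z. 0 < Im z} ?D"
    using cauchy_square_holomorphic[OF id_lebesgue_on m] by (rule holomorphic_on_imp_continuous_on)
  then have "continuous_on A (\<lambda>x. ?D (Complex x h))"
    by (rule continuous_on_compose2) (use h in \<open>auto simp: Complex_eq intro!: continuous_intros\<close>)
  then show ?thesis unfolding dkernel_eq integral_mult_right_zero by (rule continuous_on_mult_left)
qed

text \<open>The two convolutions are the real and imaginary parts of one Cauchy-type integral. Their
  differentiability is what makes the \<open>deriv\<close> in \<open>b2\<close> and
  \<open>b2_adj\<close> a genuine derivative.\<close>

lemma convolution_derivatives:
  fixes u :: "real \<Rightarrow> real"
  assumes u: "integrable (lebesgue_on S) u"
  shows "((poisson_kernel h \<star> zero_ext S u) has_real_derivative
           Re (LINT t|lebesgue_on S. u t * dkernel h (x - t))) (at x)"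
    and "((conj_poisson_kernel h \<star> zero_ext S u) has_real_derivative
           Im (LINT t|lebesgue_on S. u t * dkernel h (x - t))) (at x)"
proof -
  let ?F = "\<lambda>x. LINT t|lebesgue_on S. complex_of_real (u t) * (\<i> / of_real pi / Complex (x - t) h)"
  have cu: "integrable (lebesgue_on S) (\<lambda>t. complex_of_real (u t))" using u by simp
  have i: "integrable (lebesgue_on S) (\<lambda>t. complex_of_real (u t) * (\<i> / of_real pi / Complex (x - t) h))" for x
  proof (rule integrable_mult_bounded(1)[OF cu, where B = "1 / (pi * h)"])
    have "continuous_on UNIV (\<lambda>y. \<i> / of_real pi / Complex y h)"
      unfolding Complex_eq using h by (intro continuous_intros) (auto simp: complex_eq_iff)
    then have [measurable]: "(\<lambda>y. \<i> / of_real pi / Complex y h) \<in> borel_measurable borel"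
      by (rule borel_measurable_continuous_onI)
    show "(\<lambda>t. \<i> / of_real pi / Complex (x - t) h) \<in> borel_measurable (lebesgue_on S)" by measurable
    have "h \<le> cmod (Complex y h)" for y using abs_Im_le_cmod[of "Complex y h"] h by simp
    then show "cmod (\<i> / of_real pi / Complex (x - t) h) \<le> 1 / (pi * h)" for t
      using h by (simp add: norm_divide norm_mult frac_le)
  qed
  have scale: "Re (complex_of_real a * z) = a * Re z" "Im (complex_of_real a * z) = a * Im z" for a z
    by simp_all
  have "(poisson_kernel h \<star> zero_ext S u) = (\<lambda>x. Re (?F x))"
    by (rule ext, subst convolution_zero_ext[OF open_lebesgue[OF S(1)]], subst integral_Re[symmetric], rule i)
      (simp only: poisson_kernel_eq[OF h] scale mult.commute)
  then show "((poisson_kernel h \<star> zero_ext S u) has_real_derivative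
           Re (LINT t|lebesgue_on S. u t * dkernel h (x - t))) (at x)"
    using cauchy_transform_line_derivative[OF cu, of x]
    by (simp add: has_real_derivative_iff_has_vector_derivative has_vector_derivative_complex_iff)
  have "(conj_poisson_kernel h \<star> zero_ext S u) = (\<lambda>x. Im (?F x))"
    by (rule ext, subst convolution_zero_ext[OF open_lebesgue[OF S(1)]], subst integral_Im[symmetric], rule i)
      (simp only: conj_poisson_kernel_eq[OF h] scale mult.commute)
  then show "((conj_poisson_kernel h \<star> zero_ext S u) has_real_derivative
           Im (LINT t|lebesgue_on S. u t * dkernel h (x - t))) (at x)"
    using cauchy_transform_line_derivative[OF cu, of x]
    by (simp add: has_real_derivative_iff_has_vector_derivative has_vector_derivative_complex_iff)
qed

end

end

section \<open>The operator and its adjoint\<close>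

text \<open>Under this identification \<open>b2_adj\<close> is an integral against the single kernel
  \<open>dkernel h\<close>, and \<open>b2\<close> is minus the real part of one.\<close>

definition complex_of_pair :: "real \<times> real \<Rightarrow> complex" where
  "complex_of_pair p = Complex (fst p) (snd p)"

lemma complex_of_pair_eq: "complex_of_pair p = of_real (fst p) + \<i> * of_real (snd p)"
  by (simp add: complex_of_pair_def Complex_eq)

locale magnetization =
  fixes S K :: "real set" and h :: real
  assumes S: "open S" "bounded S" and K: "open K" "bounded K" "K \<noteq> {}" and h: "0 < h"
begin

lemma L2_pair_integrable:
  assumes "m \<in> L2 S"
  shows "integrable (lebesgue_on S) (\<lambda>t. fst (m t))" "integrable (lebesgue_on S) (\<lambda>t. snd (m t))"
    and "integrable (lebesgue_on S) (\<lambda>t. complex_of_pair (m t))"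
proof -
  show 1: "integrable (lebesgue_on S) (\<lambda>t. fst (m t))" "integrable (lebesgue_on S) (\<lambda>t. snd (m t))"
    using integrable_bounded_linear[OF bounded_linear_fst L2_integrable[OF assms S]]
      integrable_bounded_linear[OF bounded_linear_snd L2_integrable[OF assms S]] by auto
  show "integrable (lebesgue_on S) (\<lambda>t. complex_of_pair (m t))"
    unfolding complex_of_pair_eq using 1 by auto
qed

text \<open>The real part of the product of \<open>m1 + \<i> * m2\<close> and
  \<open>P' + \<i> * Q'\<close> is \<open>m1 * P' - m2 * Q'\<close>.\<close>

lemma b2_eq:
  assumes m: "m \<in> L2 S" and x: "x \<in> K"
  shows "b2 h S K m x = - Re (LINT t|lebesgue_on S. complex_of_pair (m t) * dkernel h (x - t))"
proof -
  note i = L2_pair_integrable[OF m]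
  have ci: "integrable (lebesgue_on S) (\<lambda>t. complex_of_real (fst (m t)))"
    "integrable (lebesgue_on S) (\<lambda>t. complex_of_real (snd (m t)))" using i by auto
  have "(LINT t|lebesgue_on S. complex_of_pair (m t) * dkernel h (x - t))
    = (LINT t|lebesgue_on S. of_real (fst (m t)) * dkernel h (x - t))
      + \<i> * (LINT t|lebesgue_on S. of_real (snd (m t)) * dkernel h (x - t))"
    unfolding complex_of_pair_eq distrib_right mult.assoc
    by (subst Bochner_Integration.integral_add)
      (auto intro!: integrable_mult_right integrable_dkernel(1)[OF h S] ci simp del: integrable_mult_right_iff)
  moreover have "b2 h S K m x = - (Re (LINT t|lebesgue_on S. of_real (fst (m t)) * dkernel h (x - t))
       - Im (LINT t|lebesgue_on S. of_real (snd (m t)) * dkernel h (x - t)))"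
    unfolding b2_def using x
    by (simp add: DERIV_imp_deriv[OF DERIV_diff[OF convolution_derivatives(1)[OF h S i(1)]
        convolution_derivatives(2)[OF h S i(2)]]])
  ultimately show ?thesis by simp
qed

lemma b2_adj_eq:
  assumes u: "u \<in> L2 K" and x: "x \<in> S"
  shows "complex_of_pair (b2_adj h S K u x) = (LINT t|lebesgue_on K. of_real (u t) * dkernel h (x - t))"
proof -
  have "integrable (lebesgue_on K) u" using u K by (intro L2_integrable) auto
  from DERIV_imp_deriv[OF convolution_derivatives(1)[OF h K(1,2) this]]
    DERIV_imp_deriv[OF convolution_derivatives(2)[OF h K(1,2) this]]
  show ?thesis using x by (simp add: b2_adj_def complex_of_pair_def)
qed

text \<open>The kernel integral is continuous and bounded, and \<open>K\<close> has finite
  measure.\<close>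

lemma b2_L2:
  assumes m: "m \<in> L2 S"
  shows "b2 h S K m \<in> L2 K"
proof -
  note i = L2_pair_integrable(3)[OF m]
  let ?D = "\<lambda>x. LINT t|lebesgue_on S. complex_of_pair (m t) * dkernel h (x - t)"
  have "(\<lambda>x. - Re (?D x)) \<in> L2 K"
  proof (rule continuous_bounded_L2[OF _ _ K(1,2)])
    show "continuous_on K (\<lambda>x. - Re (?D x))"
      by (intro continuous_intros continuous_on_dkernel_transform[OF h S i])
    show "norm (- Re (?D x)) \<le> 1 / (pi * h\<^sup>2) * (LINT t|lebesgue_on S. cmod (complex_of_pair (m t)))" for x
      using integrable_dkernel(2)[OF h S i, of x] abs_Re_le_cmod[of "?D x"] by simp
  qed
  then show ?thesis by (subst L2_cong[OF b2_eq[OF m]])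
qed

lemma b2_adj_L2:
  assumes u: "u \<in> L2 K"
  shows "b2_adj h S K u \<in> L2 S"
proof -
  have "integrable (lebesgue_on K) u" using u K by (intro L2_integrable) auto
  then have i: "integrable (lebesgue_on K) (\<lambda>t. complex_of_real (u t))" by simp
  let ?D = "\<lambda>x. LINT t|lebesgue_on K. of_real (u t) * dkernel h (x - t)"
  have "(\<lambda>x. (Re (?D x), Im (?D x))) \<in> L2 S"
  proof (rule continuous_bounded_L2[OF _ _ S])
    show "continuous_on S (\<lambda>x. (Re (?D x), Im (?D x)))"
      by (intro continuous_intros continuous_on_dkernel_transform[OF h K(1,2) i])
    show "norm (Re (?D x), Im (?D x)) \<le> 1 / (pi * h\<^sup>2) * (LINT t|lebesgue_on K. cmod (complex_of_real (u t)))" for x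
      using integrable_dkernel(2)[OF h K(1,2) i, of x] by (simp add: norm_Pair cmod_def)
  qed
  moreover have "b2_adj h S K u x = (Re (?D x), Im (?D x))" if "x \<in> S" for x
    using b2_adj_eq[OF u that] by (simp add: complex_of_pair_def complex_eq_iff prod_eq_iff)
  ultimately show ?thesis by (subst L2_cong)
qed

lemma b2_diff:
  assumes m: "m \<in> L2 S" "n \<in> L2 S" and x: "x \<in> K"
  shows "b2 h S K (\<lambda>t. m t - n t) x = b2 h S K m x - b2 h S K n x"
proof -
  have "complex_of_pair (m t - n t) * k = complex_of_pair (m t) * k - complex_of_pair (n t) * k" for t k
    by (simp add: complex_of_pair_eq algebra_simps)
  then show ?thesis
    unfolding b2_eq[OF L2_diff[OF m] x] b2_eq[OF m(1) x] b2_eq[OF m(2) x]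
    by (simp add: integrable_dkernel(1)[OF h S] L2_pair_integrable(3) m)
qed

lemma b2_adj_add_scaleR:
  assumes u: "u \<in> L2 K" "v \<in> L2 K" and x: "x \<in> S"
  shows "b2_adj h S K (\<lambda>t. u t + c *\<^sub>R v t) x = b2_adj h S K u x + c *\<^sub>R b2_adj h S K v x"
proof -
  have i: "integrable (lebesgue_on K) (\<lambda>t. of_real (u t) * dkernel h (x - t))" 
    "integrable (lebesgue_on K) (\<lambda>t. of_real (v t) * dkernel h (x - t))"
    using L2_integrable[OF u(1) K(1,2)] L2_integrable[OF u(2) K(1,2)]
    by (auto intro!: integrable_dkernel(1)[OF h K(1,2)])
  have "complex_of_pair (b2_adj h S K (\<lambda>t. u t + c *\<^sub>R v t) x)
    = (LINT t|lebesgue_on K. of_real (u t) * dkernel h (x - t) + of_real c * (of_real (v t) * dkernel h (x - t)))"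
    unfolding b2_adj_eq[OF L2_add[OF u(1) L2_scaleR[OF u(2)]] x]
    by (rule Bochner_Integration.integral_cong) (simp_all add: algebra_simps)
  also have "\<dots> = complex_of_pair (b2_adj h S K u x) + of_real c * complex_of_pair (b2_adj h S K v x)"
    unfolding b2_adj_eq[OF u(1) x] b2_adj_eq[OF u(2) x] using i by simp
  finally show ?thesis
    by (simp add: complex_of_pair_def complex_eq_iff prod_eq_iff)
qed

text \<open>Fubini moves the kernel from \<open>m\<close> to \<open>u\<close>. The sign and the
  conjugate from \<open>dkernel_uminus\<close> cancel the minus sign of \<open>b2\<close> and
  produce the real inner product of pairs.\<close>

lemma b2_adjoint:
  assumes m: "m \<in> L2 S" and u: "u \<in> L2 K"
  shows "L2_inner K (b2 h S K m) u = L2_inner S m (b2_adj h S K u)"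
proof -
  interpret MS: finite_measure "lebesgue_on S" by (rule finite_measure_lebesgue_on_bounded_open[OF S])
  interpret MK: finite_measure "lebesgue_on K" by (rule finite_measure_lebesgue_on_bounded_open[OF K(1,2)])
  interpret pair_sigma_finite "lebesgue_on S" "lebesgue_on K" ..
  note mi = L2_pair_integrable(3)[OF m]
  have mm [measurable]: "(\<lambda>t. complex_of_pair (m t)) \<in> borel_measurable (lebesgue_on S)" using mi by simp
  have "integrable (lebesgue_on K) u" using u K by (intro L2_integrable) auto
  then have ui: "integrable (lebesgue_on K) (\<lambda>x. complex_of_real (u x))" by simp
  then have um [measurable]: "(\<lambda>x. complex_of_real (u x)) \<in> borel_measurable (lebesgue_on K)" by simp
  note [measurable] = dkernel_measurable[OF h]
  let ?k = "dkernel h"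
  \<comment> \<open>Both factors are integrable in separate variables; multiplying by the bounded
    kernel then keeps integrability on the product.\<close>
  have prod: "integrable (lebesgue_on S \<Otimes>\<^sub>M lebesgue_on K) (\<lambda>z. complex_of_pair (m (fst z)) * of_real (u (snd z)))"
  proof (rule Fubini_integrable)
    show "(\<lambda>z. complex_of_pair (m (fst z)) * of_real (u (snd z)))
      \<in> borel_measurable (lebesgue_on S \<Otimes>\<^sub>M lebesgue_on K)" by measurable
    show "integrable (lebesgue_on S) (\<lambda>x. LINT y|lebesgue_on K.
        norm (complex_of_pair (m (fst (x, y))) * of_real (u (snd (x, y)))))"
      using mi by (simp add: norm_mult)
    show "AE x in lebesgue_on S. integrable (lebesgue_on K) (\<lambda>y. complex_of_pair (m (fst (x, y))) * of_real (u (snd (x, y))))"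
      using ui by simp
  qed
  have "integrable (lebesgue_on S \<Otimes>\<^sub>M lebesgue_on K)
    (\<lambda>z. complex_of_pair (m (fst z)) * of_real (u (snd z)) * ?k (snd z - fst z))"
    by (rule integrable_mult_bounded(1)[OF prod _ cmod_dkernel_le[OF h]]) measurable
  then have fubini: "(LINT x|lebesgue_on K. LINT t|lebesgue_on S. complex_of_pair (m t) * of_real (u x) * ?k (x - t))
     = (LINT t|lebesgue_on S. LINT x|lebesgue_on K. complex_of_pair (m t) * of_real (u x) * ?k (x - t))"
    by (intro Fubini_integral) (simp add: case_prod_beta')
  have A: "(LINT t|lebesgue_on S. complex_of_pair (m t) * of_real (u x) * ?k (x - t))
    = of_real (u x) * (LINT t|lebesgue_on S. complex_of_pair (m t) * ?k (x - t))" for x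
    unfolding integral_mult_right_zero[symmetric]
    by (rule Bochner_Integration.integral_cong) (simp_all add: mult_ac)
  have B: "(LINT x|lebesgue_on K. complex_of_pair (m t) * of_real (u x) * ?k (x - t))
    = - complex_of_pair (m t) * cnj (complex_of_pair (b2_adj h S K u t))" if "t \<in> S" for t
  proof -
    have "?k (x - t) = - cnj (?k (t - x))" for x
      using dkernel_uminus[of h "t - x"] by simp
    then have "(LINT x|lebesgue_on K. complex_of_pair (m t) * of_real (u x) * ?k (x - t))
      = (LINT x|lebesgue_on K. - complex_of_pair (m t) * cnj (of_real (u x) * ?k (t - x)))"
      by (intro Bochner_Integration.integral_cong) (simp_all add: mult_ac)
    then show ?thesis
      by (simp only: integral_mult_right_zero Bochner_Integration.integral_cnj b2_adj_eq[OF u that])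
  qed
  let ?U = "\<lambda>t. complex_of_pair (m t) * cnj (complex_of_pair (b2_adj h S K u t))"
  \<comment> \<open>The Euclidean inner product of two pairs is the real part of one complex number
    times the conjugate of the other.\<close>
  have inner: "m t \<bullet> b2_adj h S K u t = Re (?U t)" for t
    by (simp add: complex_of_pair_def inner_prod_def)
  have Ui: "integrable (lebesgue_on S) ?U"
  proof (rule Bochner_Integration.integrable_bound)
    show "integrable (lebesgue_on S) (\<lambda>t. (norm (m t))\<^sup>2 + (norm (b2_adj h S K u t))\<^sup>2)"
      using m b2_adj_L2[OF u] by (auto intro: L2_square_integrable)
    have "integrable (lebesgue_on S) (\<lambda>t. cnj (complex_of_pair (b2_adj h S K u t)))"
      using L2_pair_integrable(3)[OF b2_adj_L2[OF u]] by simp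
    then show "?U \<in> borel_measurable (lebesgue_on S)"
      by (intro borel_measurable_times mm borel_measurable_integrable)
    have n: "cmod (complex_of_pair p) = norm p" for p
      by (cases p) (simp add: complex_of_pair_def norm_Pair cmod_def)
    have "norm (m t) * norm (b2_adj h S K u t) \<le> (norm (m t))\<^sup>2 + (norm (b2_adj h S K u t))\<^sup>2" for t
      using sum_squares_bound[of "norm (m t)" "norm (b2_adj h S K u t)"]
        mult_nonneg_nonneg[OF norm_ge_zero[of "m t"] norm_ge_zero[of "b2_adj h S K u t"]]
      by linarith
    then show "AE t in lebesgue_on S. cmod (?U t) \<le> norm ((norm (m t))\<^sup>2 + (norm (b2_adj h S K u t))\<^sup>2)"
      by (auto simp: norm_mult n intro: order_trans)
  qed
  have Vi: "integrable (lebesgue_on K) (\<lambda>x. of_real (u x) * (LINT t|lebesgue_on S. complex_of_pair (m t) * ?k (x - t)))"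
  proof (rule integrable_mult_bounded(1)[OF ui])
    show "(\<lambda>x. LINT t|lebesgue_on S. complex_of_pair (m t) * ?k (x - t)) \<in> borel_measurable (lebesgue_on K)"
      using continuous_on_dkernel_transform[OF h S mi, of K] K
      by (intro continuous_imp_measurable_on_sets_lebesgue) auto
    show "cmod (LINT t|lebesgue_on S. complex_of_pair (m t) * ?k (x - t))
      \<le> 1 / (pi * h\<^sup>2) * (LINT t|lebesgue_on S. cmod (complex_of_pair (m t)))" for x
      by (rule integrable_dkernel(2)[OF h S mi])
  qed
  have "L2_inner K (b2 h S K m) u = (LINT x|lebesgue_on K. - Re (of_real (u x) * (LINT t|lebesgue_on S. complex_of_pair (m t) * ?k (x - t))))"
    unfolding L2_inner_def by (rule Bochner_Integration.integral_cong) (simp_all add: b2_eq[OF m])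
  also have "\<dots> = - Re (LINT x|lebesgue_on K. LINT t|lebesgue_on S. complex_of_pair (m t) * of_real (u x) * ?k (x - t))"
    unfolding A using Vi by (simp del: times_complex.sel)
  also have "\<dots> = - Re (LINT t|lebesgue_on S. - ?U t)"
    unfolding fubini by (subst Bochner_Integration.integral_cong[OF refl B]) (simp_all del: times_complex.sel)
  also have "\<dots> = L2_inner S m (b2_adj h S K u)"
    unfolding L2_inner_def inner using Ui by (simp del: times_complex.sel)
  finally show ?thesis .
qed

text \<open>Continuity upgrades the almost-everywhere equation to all of \<open>K\<close>; the
  reflection argument then kills the Cauchy transform, and the moment argument kills each component
  of \<open>m\<close>.\<close>

lemma b2_injective:
  assumes m: "m \<in> L2 S" and b0: "AE x in lebesgue_on K. b2 h S K m x = 0"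
  shows "AE t in lebesgue_on S. m t = 0"
proof -
  note mi = L2_pair_integrable(3)[OF m]
  let ?D = "\<lambda>x. LINT t|lebesgue_on S. complex_of_pair (m t) * dkernel h (x - t)"
  have "AE x in lebesgue. x \<in> K \<longrightarrow> Re (?D x) = 0"
    using b0 K(1) by (simp add: AE_restrict_space_iff b2_eq[OF m])
  then have "AE x in lebesgue. \<not> (x \<in> K \<and> Re (?D x) \<noteq> 0)" by eventually_elim auto
  then obtain N where "N \<in> null_sets lebesgue" "{x \<in> K. Re (?D x) \<noteq> 0} \<subseteq> N"
    by (auto simp: eventually_ae_filter)
  \<comment> \<open>The set where the continuous function is nonzero is both open and negligible,
    hence empty.\<close>
  then have "negligible {x \<in> K. Re (?D x) \<noteq> 0}"
    by (auto simp: negligible_iff_null_sets[symmetric] intro: negligible_subset)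
  moreover have "open {x \<in> K. Re (?D x) \<noteq> 0}"
  proof -
    have "continuous_on K (\<lambda>x. Re (?D x))"
      by (intro continuous_intros continuous_on_dkernel_transform[OF h S mi])
    then have "open (K \<inter> (\<lambda>x. Re (?D x)) -` (- {0}))"
      using K(1) by (intro continuous_open_preimage) auto
    moreover have "K \<inter> (\<lambda>x. Re (?D x)) -` (- {0}) = {x \<in> K. Re (?D x) \<noteq> 0}" by auto
    ultimately show ?thesis by simp
  qed
  ultimately have "{x \<in> K. Re (?D x) \<noteq> 0} = {}"
    using open_not_negligible by blast
  then have Re0: "Re (?D x) = 0" if "x \<in> K" for x using that by blast
  \<comment> \<open>The factor \<open>- \<i> / \<pi>\<close> in \<open>dkernel\<close> turns a
    vanishing real part into a vanishing imaginary part.\<close>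
  have Im0: "Im (LINT t|lebesgue_on S. complex_of_pair (m t) / (Complex x h - of_real t)\<^sup>2) = 0" if "x \<in> K" for x
    using Re0[OF that] unfolding dkernel_eq integral_mult_right_zero by simp
  obtain r where r: "\<And>t. t \<in> S \<Longrightarrow> \<bar>t\<bar> \<le> r" using S(2) by (auto simp: bounded_iff)
  have F0: "(LINT t|lebesgue_on S. complex_of_pair (m t) / (Complex 0 y - of_real t)) = 0" if "h \<le> y" for y
    by (rule cauchy_transform_eq_0[OF id_lebesgue_on mi h K(1,3) Im0]) (use that in auto)
  have mom: "(LINT t|lebesgue_on S. complex_of_pair (m t) * of_real t ^ n) = 0" for n
    by (rule moment_eq_0[OF id_lebesgue_on mi h _ F0]) (use r in auto)
  have momi: "integrable (lebesgue_on S) (\<lambda>t. complex_of_pair (m t) * of_real t ^ n)" for n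
    using moment_integrable[OF id_lebesgue_on mi, of r n] r by simp
  have "(LINT t|lebesgue_on S. fst (m t) * t ^ n) = 0" for n
    using arg_cong[OF mom[of n], of Re] integral_Re[OF momi[of n]]
    by (simp add: complex_of_pair_def flip: of_real_power)
  moreover have "(LINT t|lebesgue_on S. snd (m t) * t ^ n) = 0" for n
    using arg_cong[OF mom[of n], of Im] integral_Im[OF momi[of n]]
    by (simp add: complex_of_pair_def flip: of_real_power)
  ultimately have "AE t in lebesgue_on S. fst (m t) = 0" "AE t in lebesgue_on S. snd (m t) = 0"
    using moments_eq_0_imp_AE_eq_0[OF open_lebesgue[OF S(1)] r L2_pair_integrable(1)[OF m]]
      moments_eq_0_imp_AE_eq_0[OF open_lebesgue[OF S(1)] r L2_pair_integrable(2)[OF m]] by auto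
  then show ?thesis by eventually_elim (simp add: prod_eq_iff)
qed

end

section \<open>First variation on the ball and the multiplier\<close>

theorem mainTheorem4:
  fixes S K :: "real set" and h M :: real
    and e :: "real \<Rightarrow> real \<times> real" and \<phi>\<^sub>o :: "real \<Rightarrow> real"
  assumes "open S" "is_interval S" "bounded S" "S \<noteq> {}"
    and "open K" "is_interval K" "bounded K" "K \<noteq> {}"
    and "h > 0" and "M > 0"
    and "e \<in> L2 S" and "e \<notin> Ran_b2_adj h S K"
    and "is_arg_min (\<lambda>\<phi>. L2_norm S (\<lambda>x. b2_adj h S K \<phi> x - e x))
           (\<lambda>\<phi>. \<phi> \<in> L2 K \<and> L2_norm K \<phi> \<le> M) \<phi>\<^sub>o"
  shows "(\<exists>!lam::real. lam > 0 \<and>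
            L2_eq K (\<lambda>x. b2 h S K (b2_adj h S K \<phi>\<^sub>o) x + lam * \<phi>\<^sub>o x) (b2 h S K e))
         \<and> L2_norm K \<phi>\<^sub>o = M"
proof -
  interpret magnetization S K h by standard (use assms in auto)
  let ?J = "\<lambda>\<phi>. L2_norm S (\<lambda>x. b2_adj h S K \<phi> x - e x)"
  have \<phi>: "\<phi>\<^sub>o \<in> L2 K" "L2_norm K \<phi>\<^sub>o \<le> M"
    and min: "\<And>\<psi>. \<psi> \<in> L2 K \<Longrightarrow> L2_norm K \<psi> \<le> M \<Longrightarrow> ?J \<phi>\<^sub>o \<le> ?J \<psi>"
    using assms(13) by (auto simp: is_arg_min_def not_less)
  have \<phi>_inner: "L2_inner K \<phi>\<^sub>o \<phi>\<^sub>o \<le> M\<^sup>2"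
    using power_mono[OF \<phi>(2) L2_norm_nonneg, of 2] by (simp add: L2_norm_power2)
  define r where "r x = b2_adj h S K \<phi>\<^sub>o x - e x" for x
  have rL2: "r \<in> L2 S" unfolding r_def using b2_adj_L2[OF \<phi>(1)] assms(11) by (rule L2_diff)
  \<comment> \<open>This is the gradient at \<open>\<phi>\<^sub>o\<close> of half the squared
    distance to \<open>e\<close>.\<close>
  define g where "g = b2 h S K r"
  have gL2: "g \<in> L2 K" unfolding g_def by (rule b2_L2[OF rL2])
  have g_eq: "g x = b2 h S K (b2_adj h S K \<phi>\<^sub>o) x - b2 h S K e x" if "x \<in> K" for x
    unfolding g_def r_def[abs_def] using b2_adj_L2[OF \<phi>(1)] assms(11) that by (rule b2_diff)
  define G where "G = L2_norm K g"
  have G2: "G\<^sup>2 = L2_inner K g g" by (simp add: G_def L2_norm_power2)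
  have "G \<noteq> 0"
  proof
    assume "G = 0"
    then have "AE x in lebesgue_on K. b2 h S K r x = 0"
      using L2_inner_eq_0_imp_AE[OF gL2] G2 by (simp add: g_def)
    then have "AE t in lebesgue_on S. r t = 0" by (rule b2_injective[OF rL2])
    then have "L2_eq S (b2_adj h S K \<phi>\<^sub>o) e" by (simp add: L2_eq_def r_def)
    then show False using assms(11,12) \<phi>(1) by (auto simp: Ran_b2_adj_def)
  qed
  then have G: "0 < G" by (simp add: G_def L2_norm_nonneg order_less_le)
  \<comment> \<open>The direction from \<open>\<phi>\<^sub>o\<close> to
    \<open>- (M / G) * g\<close>, the point of the ball where the linear form given by
    \<open>g\<close> is smallest.\<close>
  define \<delta> where "\<delta> x = (- M / G) *\<^sub>R g x + (- 1) *\<^sub>R \<phi>\<^sub>o x" for x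
  have \<delta>L2: "\<delta> \<in> L2 K" unfolding \<delta>_def by (intro L2_add L2_scaleR gL2 \<phi>)
  define A where "A = b2_adj h S K \<delta>"
  have AL2: "A \<in> L2 S" unfolding A_def by (rule b2_adj_L2[OF \<delta>L2])
  \<comment> \<open>Minimality compares the squared norms of \<open>r\<close> and
    \<open>r + s * A\<close>; the common factor \<open>s > 0\<close> is divided out.\<close>
  have var: "0 \<le> 2 * L2_inner S r A + s * L2_inner S A A" if s: "0 < s" "s \<le> 1" for s
  proof -
    define \<psi> where "\<psi> x = \<phi>\<^sub>o x + s *\<^sub>R \<delta> x" for x
    have \<psi>L2: "\<psi> \<in> L2 K" unfolding \<psi>_def by (intro L2_add L2_scaleR \<phi> \<delta>L2)
    have "L2_inner K \<psi> \<psi> \<le> (LINT x|lebesgue_on K. (1 - s) * (\<phi>\<^sub>o x \<bullet> \<phi>\<^sub>o x) + s * (M\<^sup>2 / G\<^sup>2) * (g x \<bullet> g x))"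
      unfolding L2_inner_def
    proof (rule integral_mono)
      fix x
      let ?a = "\<phi>\<^sub>o x" and ?b = "- M / G * g x"
      \<comment> \<open>Pointwise convexity of the square; integrated, it shows that the segment
        stays in the ball.\<close>
      have "(1 - s) * a\<^sup>2 + s * b\<^sup>2 - ((1 - s) * a + s * b)\<^sup>2 = s * (1 - s) * (a - b)\<^sup>2" for a b :: real
        by (simp add: power2_eq_square algebra_simps)
      from this[of ?a ?b] have "((1 - s) * ?a + s * ?b)\<^sup>2 = (1 - s) * ?a\<^sup>2 + s * ?b\<^sup>2 - s * (1 - s) * (?a - ?b)\<^sup>2"
        by linarith
      moreover have "0 \<le> s * (1 - s) * (?a - ?b)\<^sup>2" using s by simp
      moreover have "\<psi> x = (1 - s) * ?a + s * ?b" by (simp add: \<psi>_def \<delta>_def algebra_simps)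
      ultimately have "(\<psi> x)\<^sup>2 \<le> (1 - s) * ?a\<^sup>2 + s * ?b\<^sup>2" by (simp only: diff_le_eq le_add_same_cancel1)
      also have "?b\<^sup>2 = M\<^sup>2 / G\<^sup>2 * (g x)\<^sup>2" by (simp add: power_divide power_mult_distrib)
      finally show "\<psi> x \<bullet> \<psi> x \<le> (1 - s) * (\<phi>\<^sub>o x \<bullet> \<phi>\<^sub>o x) + s * (M\<^sup>2 / G\<^sup>2) * (g x \<bullet> g x)"
        by (simp add: power2_eq_square mult.assoc)
    qed (intro L2_inner_integrable \<psi>L2 \<phi> gL2 Bochner_Integration.integrable_add integrable_mult_right)+
    also have "\<dots> = (1 - s) * L2_inner K \<phi>\<^sub>o \<phi>\<^sub>o + s * (M\<^sup>2 / G\<^sup>2) * L2_inner K g g"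
      unfolding L2_inner_def
      by (simp only: Bochner_Integration.integral_add[OF integrable_mult_right[OF L2_inner_integrable[OF \<phi>(1) \<phi>(1)]]
            integrable_mult_right[OF L2_inner_integrable[OF gL2 gL2]]] integral_mult_right_zero)
    also have "\<dots> \<le> (1 - s) * M\<^sup>2 + s * (M\<^sup>2 / G\<^sup>2) * G\<^sup>2"
      using \<phi>_inner s G2 by (simp add: mult_left_mono)
    also have "\<dots> = M\<^sup>2" using G by (simp add: algebra_simps)
    finally have "L2_norm K \<psi> \<le> M"
      using assms(10) unfolding L2_norm_def by (intro real_le_lsqrt) auto
    from power_mono[OF min[OF \<psi>L2 this] L2_norm_nonneg, of 2] have "L2_inner S r r \<le> (?J \<psi>)\<^sup>2"
      by (simp add: L2_norm_power2 r_def[abs_def])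
    also have "\<dots> = L2_inner S (\<lambda>x. r x + s *\<^sub>R A x) (\<lambda>x. r x + s *\<^sub>R A x)"
      unfolding L2_norm_power2
      by (rule L2_inner_cong)
        (simp_all add: r_def A_def \<psi>_def[abs_def] b2_adj_add_scaleR[OF \<phi>(1) \<delta>L2, simplified real_scaleR_def])
    also have "\<dots> = L2_inner S r r + 2 * s * L2_inner S r A + s\<^sup>2 * L2_inner S A A"
      by (rule L2_inner_add_scaleR[OF rL2 AL2])
    finally have "0 \<le> s * (2 * L2_inner S r A + s * L2_inner S A A)"
      by (simp add: algebra_simps power2_eq_square)
    then show ?thesis using s by (simp add: zero_le_mult_iff)
  qed
  \<comment> \<open>Let \<open>s\<close> tend to 0 from the right in the variational
    inequality.\<close>
  have "0 \<le> 2 * L2_inner S r A"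
  proof (rule tendsto_lowerbound)
    show "((\<lambda>s. 2 * L2_inner S r A + s * L2_inner S A A) \<longlongrightarrow> 2 * L2_inner S r A) (at_right 0)"
      by (auto intro!: tendsto_eq_intros)
    show "\<forall>\<^sub>F s in at_right 0. 0 \<le> 2 * L2_inner S r A + s * L2_inner S A A"
      using var by (intro eventually_at_rightI[of 0 1]) auto
  qed simp
  also have "L2_inner S r A = L2_inner K g \<delta>"
    unfolding A_def g_def by (rule b2_adjoint[OF rL2 \<delta>L2, symmetric])
  also have "\<dots> = (LINT x|lebesgue_on K. (- M / G) * (g x \<bullet> g x) - g x \<bullet> \<phi>\<^sub>o x)"
    unfolding L2_inner_def by (rule Bochner_Integration.integral_cong) (simp_all add: \<delta>_def algebra_simps)
  also have "\<dots> = (- M / G) * L2_inner K g g - L2_inner K g \<phi>\<^sub>o"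
    unfolding L2_inner_def
    by (simp only: Bochner_Integration.integral_diff[OF integrable_mult_right[OF L2_inner_integrable[OF gL2 gL2]]
          L2_inner_integrable[OF gL2 \<phi>(1)]] integral_mult_right_zero)
  also have "\<dots> = - M * G - L2_inner K g \<phi>\<^sub>o"
    using G by (simp add: G2[symmetric] power2_eq_square)
  finally have g\<phi>: "L2_inner K g \<phi>\<^sub>o \<le> - M * G" by (simp add: mult.commute)
  \<comment> \<open>Expanding the squared norm of \<open>f\<close> with the last bound gives at most
    \<open>M^2 - 2 * M^2 + M^2 = 0\<close>, which forces
    \<open>\<phi>\<^sub>o = - (M / G) * g\<close> almost everywhere.\<close>
  define f where "f x = \<phi>\<^sub>o x + (M / G) *\<^sub>R g x" for x
  have "L2_inner K f f = L2_inner K \<phi>\<^sub>o \<phi>\<^sub>o + 2 * (M / G) * L2_inner K \<phi>\<^sub>o g + (M / G)\<^sup>2 * L2_inner K g g"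
    unfolding f_def by (rule L2_inner_add_scaleR[OF \<phi>(1) gL2])
  also have "\<dots> \<le> M\<^sup>2 + 2 * (M / G) * (- M * G) + (M / G)\<^sup>2 * G\<^sup>2"
    using \<phi>_inner g\<phi> G assms(10) unfolding G2
    by (intro add_mono mult_left_mono) (auto simp: L2_inner_def mult.commute)
  also have "\<dots> = 0" using G by (simp add: power2_eq_square field_simps)
  finally have "L2_inner K f f = 0" using L2_inner_nonneg[of K f] by simp
  moreover have "f \<in> L2 K" unfolding f_def by (intro L2_add L2_scaleR gL2 \<phi>)
  ultimately have f0: "AE x in lebesgue_on K. f x = 0" by (intro L2_inner_eq_0_imp_AE)
  have \<phi>m: "\<phi>\<^sub>o \<in> borel_measurable (lebesgue_on K)" and gm: "g \<in> borel_measurable (lebesgue_on K)"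
    using \<phi>(1) gL2 by (auto intro: L2_measurable)
  have "L2_inner K \<phi>\<^sub>o \<phi>\<^sub>o = (LINT x|lebesgue_on K. (M / G)\<^sup>2 * (g x \<bullet> g x))"
    unfolding L2_inner_def
  proof (rule integral_cong_AE)
    show "AE x in lebesgue_on K. \<phi>\<^sub>o x \<bullet> \<phi>\<^sub>o x = (M / G)\<^sup>2 * (g x \<bullet> g x)"
      using f0
    proof eventually_elim
      case (elim x)
      then have "\<phi>\<^sub>o x = - (M / G) * g x" by (simp add: f_def)
      then show ?case by (simp add: power2_eq_square)
    qed
  qed (use \<phi>m gm in auto)
  also have "\<dots> = (M / G)\<^sup>2 * G\<^sup>2" unfolding G2 L2_inner_def by simp
  also have "\<dots> = M\<^sup>2" using G by (simp add: power_divide)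
  finally have norm: "L2_norm K \<phi>\<^sub>o = M" using assms(10) by (simp add: L2_norm_def)
  have AEK: "AE x in lebesgue_on K. x \<in> K" using AE_space[of "lebesgue_on K"] by simp
  \<comment> \<open>Almost everywhere on \<open>K\<close>, the left side minus the right side is
    \<open>g + lam * \<phi>\<^sub>o\<close>, and \<open>g = - (G / M) * \<phi>\<^sub>o\<close>. One
    equivalence thus serves existence and uniqueness.\<close>
  have iff: "L2_eq K (\<lambda>x. b2 h S K (b2_adj h S K \<phi>\<^sub>o) x + lam * \<phi>\<^sub>o x) (b2 h S K e)
      \<longleftrightarrow> (AE x in lebesgue_on K. (lam - G / M) * \<phi>\<^sub>o x = 0)" for lam
    unfolding L2_eq_def
  proof (rule eventually_subst)
    show "AE x in lebesgue_on K. (b2 h S K (b2_adj h S K \<phi>\<^sub>o) x + lam * \<phi>\<^sub>o x = b2 h S K e x)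
        = ((lam - G / M) * \<phi>\<^sub>o x = 0)"
      using f0 AEK
    proof eventually_elim
      case (elim x)
      then have "G / M * \<phi>\<^sub>o x + g x = 0"
        using G assms(10) by (simp add: f_def field_simps)
      then show ?case using g_eq[OF elim(2)] by (auto simp: algebra_simps)
    qed
  qed
  \<comment> \<open>Since \<open>\<phi>\<^sub>o\<close> has norm \<open>M > 0\<close>, the
    coefficient \<open>lam - G / M\<close> must vanish.\<close>
  have "\<not> (AE x in lebesgue_on K. \<phi>\<^sub>o x = 0)"
  proof
    assume "AE x in lebesgue_on K. \<phi>\<^sub>o x = 0"
    then have "L2_inner K \<phi>\<^sub>o \<phi>\<^sub>o = (LINT x|lebesgue_on K. 0)"
      unfolding L2_inner_def using \<phi>m by (intro integral_cong_AE) auto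
    then show False using norm assms(10) by (simp add: L2_norm_def)
  qed
  then have "L2_eq K (\<lambda>x. b2 h S K (b2_adj h S K \<phi>\<^sub>o) x + lam * \<phi>\<^sub>o x) (b2 h S K e) \<longleftrightarrow> lam = G / M" for lam
    unfolding iff by auto
  moreover have "0 < G / M" using G assms(10) by simp
  ultimately show ?thesis using norm by auto
qed

end
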